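(* Let $\mathcal F$ be a multigraph family and let $\operatorname{Patch}_{\mathcal F}(z,w,u)$ be the generating function of canonically labeled $\mathcal F$-patchworks. Then for all integers $n,m,t\ge 0$, the number $\operatorname{MG}^{\mathcal F}_{n,m,t}$ of $(n,m)$-multigraphs that contain exactly $t$ $\mathcal F$-subgraphs is \[ \operatorname{MG}^{\mathcal F}_{n,m,t} = n!\,2^m\,m!\,[z^n w^m u^t]\, \operatorname{Patch}_{\mathcal F}(z,w,u-1)\, e^{z}\, e^{n^2 w/2}. \]
   Context: A multigraph $G$ consists of a finite set $V(G)$ of vertices carrying distinct integer labels and a finite set $E(G)$ of edges, each a triple $(v,w,e)$ with $v,w\in V(G)$ (oriented from $v$ to $w$, loops allowed) and $e$ a distinct integer edge label; multiple edges allowed. An $(n,m)$-multigraph has vertex labels $1,\dots,n$ and edge labels $1,\dots,m$. Isomorphism ignores labels (bijections on vertices and edges preserving endpoints and orientation); $F\subset G$ means $V(F)\subset V(G)$, $E(F)\subset E(G)$. A multigraph family $\mathcal F$ is a set of canonically labeled multigraphs closed under isomorphism; an $\mathcal F$-subgraph (or $\mathcal F$-multigraph) is a multigraph isomorphic to an element of $\mathcal F$. An $\mathcal F$-patchwork $P$ is a finite set (possibly empty) of distinct $\mathcal F$-multigraphs (its pieces), each carrying arbitrary distinct integer vertex labels and distinct integer edge labels, where vertices of different pieces with the same label are identified and edges of different pieces with the same label are identified (so edges sharing a label join the same two vertices with the same orientation). Its vertex set $V(P)$ and edge set $E(P)$ are the unions of those of the pieces, $n(P)=|V(P)|$, $m(P)=|E(P)|$,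 and $|P|$ is the number of pieces. $P$ is canonically labeled if $V(P)$ has labels $1,\dots,n(P)$ and $E(P)$ has labels $1,\dots,m(P)$. The generating function is $\operatorname{Patch}_{\mathcal F}(z,w,u)=\sum_{P} u^{|P|}\frac{w^{m(P)}}{2^{m(P)}m(P)!}\frac{z^{n(P)}}{n(P)!}$, summed over canonically labeled $\mathcal F$-patchworks. *)

theory Defs
  imports "HOL-Computational_Algebra.Computational_Algebra"
begin

section \<open>Multigraphs\<close>

text \<open>
  Vertices are identified with their integer labels. An edge is a triple \<open>(v, w, e)\<close>: source,
  target, edge label. Since everything is labelled, equality of multigraphs is equality of both
  sets. Well-formedness is the predicate \<open>multigraph\<close> below.
\<close>

type_synonym edge = "int \<times> int \<times> int"

datatype mgraph = MGraph (verts: "int set") (edges: "edge set")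

definition src :: "edge \<Rightarrow> int" where "src = (\<lambda>(v, w, e). v)"
definition tgt :: "edge \<Rightarrow> int" where "tgt = (\<lambda>(v, w, e). w)"
definition lab :: "edge \<Rightarrow> int" where "lab = (\<lambda>(v, w, e). e)"

definition multigraph :: "mgraph \<Rightarrow> bool" where
  "multigraph G \<longleftrightarrow> finite (verts G) \<and> finite (edges G) \<and>
     (\<forall>x\<in>edges G. src x \<in> verts G \<and> tgt x \<in> verts G) \<and> inj_on lab (edges G)"

definition nm_multigraph :: "nat \<Rightarrow> nat \<Rightarrow> mgraph \<Rightarrow> bool" where
  "nm_multigraph n m G \<longleftrightarrow> multigraph G \<and> verts G = {1..int n} \<and> lab ` edges G = {1..int m}"

definition canonical :: "mgraph \<Rightarrow> bool" where
  "canonical G \<longleftrightarrow> (\<exists>n m. nm_multigraph n m G)"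

definition isomorphic :: "mgraph \<Rightarrow> mgraph \<Rightarrow> bool" where
  "isomorphic G H \<longleftrightarrow> (\<exists>f g. bij_betw f (verts G) (verts H) \<and> bij_betw g (edges G) (edges H) \<and>
     (\<forall>x\<in>edges G. src (g x) = f (src x) \<and> tgt (g x) = f (tgt x)))"

definition subgraph :: "mgraph \<Rightarrow> mgraph \<Rightarrow> bool" where
  "subgraph H G \<longleftrightarrow> verts H \<subseteq> verts G \<and> edges H \<subseteq> edges G"

section \<open>Families and patchworks\<close>

definition multigraph_family :: "mgraph set \<Rightarrow> bool" where
  "multigraph_family \<F> \<longleftrightarrow> (\<forall>G\<in>\<F>. canonical G) \<and>
     (\<forall>G\<in>\<F>. \<forall>H. canonical H \<and> isomorphic G H \<longrightarrow> H \<in> \<F>)"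

definition family_multigraph :: "mgraph set \<Rightarrow> mgraph \<Rightarrow> bool" where
  "family_multigraph \<F> H \<longleftrightarrow> multigraph H \<and> (\<exists>F\<in>\<F>. isomorphic H F)"

definition family_subgraphs :: "mgraph set \<Rightarrow> mgraph \<Rightarrow> mgraph set" where
  "family_subgraphs \<F> G = {H. family_multigraph \<F> H \<and> subgraph H G}"

definition MG :: "mgraph set \<Rightarrow> nat \<Rightarrow> nat \<Rightarrow> nat \<Rightarrow> nat" where
  "MG \<F> n m t = card {G. nm_multigraph n m G \<and> card (family_subgraphs \<F> G) = t}"

definition pverts :: "mgraph set \<Rightarrow> int set" where "pverts P = (\<Union>G\<in>P. verts G)"
definition pedges :: "mgraph set \<Rightarrow> edge set" where "pedges P = (\<Union>G\<in>P. edges G)"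

text \<open>
  The identification of equally labelled edges of different pieces is injectivity of \<open>lab\<close> on the
  union: edges sharing a label are the same triple, hence have the same source and target.
\<close>

definition patchwork :: "mgraph set \<Rightarrow> mgraph set \<Rightarrow> bool" where
  "patchwork \<F> P \<longleftrightarrow> finite P \<and> (\<forall>G\<in>P. family_multigraph \<F> G) \<and> inj_on lab (pedges P)"

definition canonical_patchwork :: "mgraph set \<Rightarrow> mgraph set \<Rightarrow> bool" where
  "canonical_patchwork \<F> P \<longleftrightarrow> patchwork \<F> P \<and>
     pverts P = {1..int (card (pverts P))} \<and> lab ` pedges P = {1..int (card (pedges P))}"

definition canonical_patchworks :: "mgraph set \<Rightarrow> nat \<Rightarrow> nat \<Rightarrow> mgraph set set" where
  "canonical_patchworks \<F> n m =
     {P. canonical_patchwork \<F> P \<and> card (pverts P) = n \<and> card (pedges P) = m}"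

text \<open>The sums defining the coefficients of the generating function are finite.\<close>

lemma finite_canonical_patchworks: "finite (canonical_patchworks \<F> n m)"
proof -
  let ?V = "{1..int n}" and ?L = "{1..int m}"
  let ?B = "case_prod MGraph ` (Pow ?V \<times> Pow (?V \<times> ?V \<times> ?L))"
  have "P \<subseteq> ?B" if P: "P \<in> canonical_patchworks \<F> n m" for P
  proof
    fix G assume G: "G \<in> P"
    have V: "pverts P = ?V" and L: "lab ` pedges P = ?L"
      and mg: "multigraph G"
      using P G by (auto simp: canonical_patchworks_def canonical_patchwork_def patchwork_def
          family_multigraph_def)
    have "verts G \<subseteq> ?V" using V G by (auto simp: pverts_def)
    moreover have "edges G \<subseteq> ?V \<times> ?V \<times> ?L"
    proof
      fix x assume x: "x \<in> edges G"
      have "src x \<in> ?V" "tgt x \<in> ?V"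
        using mg x \<open>verts G \<subseteq> ?V\<close> unfolding multigraph_def by blast+
      moreover have "lab x \<in> ?L" using L G x unfolding pedges_def by blast
      ultimately show "x \<in> ?V \<times> ?V \<times> ?L"
        by (cases x) (simp add: src_def tgt_def lab_def)
    qed
    ultimately show "G \<in> ?B"
      by (intro image_eqI[where x = "(verts G, edges G)"]) auto
  qed
  then have "canonical_patchworks \<F> n m \<subseteq> Pow ?B" by blast
  then show ?thesis by (rule finite_subset) simp
qed

section \<open>Generating function\<close>

text \<open>
  Series in \<open>z\<close> and \<open>w\<close> whose coefficients are polynomials in \<open>u\<close> are elements of
  \<open>\<rat>[u][[w]][[z]]\<close>: the outer series variable is \<open>z\<close>, the inner one is \<open>w\<close>. Polynomial
  coefficients make the substitution of \<open>u - 1\<close> for \<open>u\<close> well defined.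
\<close>

type_synonym zwu_series = "rat poly fps fps"

definition coeff_zwu :: "nat \<Rightarrow> nat \<Rightarrow> nat \<Rightarrow> zwu_series \<Rightarrow> rat" where
  "coeff_zwu n m t A = coeff (fps_nth (fps_nth A n) m) t"

definition Patch :: "mgraph set \<Rightarrow> zwu_series" where
  "Patch \<F> = Abs_fps (\<lambda>n. Abs_fps (\<lambda>m.
     \<Sum>P\<in>canonical_patchworks \<F> n m. monom (1 / (2 ^ m * fact m * fact n)) (card P)))"

definition map_fps :: "('a \<Rightarrow> 'b) \<Rightarrow> 'a fps \<Rightarrow> 'b fps" where
  "map_fps f A = Abs_fps (\<lambda>k. f (fps_nth A k))"

definition subst_u :: "rat poly \<Rightarrow> zwu_series \<Rightarrow> zwu_series" where
  "subst_u q = map_fps (map_fps (\<lambda>p. pcompose p q))"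

text \<open>\<open>exp_z c\<close> and \<open>exp_w c\<close> are \<open>e\<^sup>c\<^sup>z\<close> and \<open>e\<^sup>c\<^sup>w\<close>, embedded from one-variable series over \<open>\<rat>\<close>.\<close>

definition exp_z :: "rat \<Rightarrow> zwu_series" where
  "exp_z c = map_fps (\<lambda>a. fps_const [:a:]) (fps_exp c)"

definition exp_w :: "rat \<Rightarrow> zwu_series" where
  "exp_w c = fps_const (map_fps (\<lambda>a. [:a:]) (fps_exp c))"

end

theory Submission imports Defs begin

text \<open>
  By the binomial theorem \<open>u\<^sup>s = (\<Sum>k. (s choose k) * (u - 1)\<^sup>k)\<close>, so weighting every
  \<open>(n, m)\<close>-multigraph by \<open>u\<close> to the number of its \<open>\<F>\<close>-subgraphs is the same as weighting every pair
  of a multigraph and a set of distinguished \<open>\<F>\<close>-subgraphs of it by \<open>u - 1\<close> to the number of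
  distinguished subgraphs. The distinguished subgraphs form a patchwork \<open>P\<close>, and such pairs can be
  counted starting from \<open>P\<close>: choose the vertex labels and the edge labels of \<open>P\<close>, choose a canonical
  patchwork to be transported to these labels, and give arbitrary end points to the remaining edge
  labels, in \<open>n\<^sup>2\<close> ways each.
\<close>

section \<open>Relabelling\<close>

definition relabel_edge :: "(int \<Rightarrow> int) \<Rightarrow> (int \<Rightarrow> int) \<Rightarrow> edge \<Rightarrow> edge" where
  "relabel_edge f g = (\<lambda>(v, w, e). (f v, f w, g e))"

definition relabel :: "(int \<Rightarrow> int) \<Rightarrow> (int \<Rightarrow> int) \<Rightarrow> mgraph \<Rightarrow> mgraph" where
  "relabel f g G = MGraph (f ` verts G) (relabel_edge f g ` edges G)"

lemma relabel_edge_simps [simp]: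
  "src (relabel_edge f g x) = f (src x)"
  "tgt (relabel_edge f g x) = f (tgt x)"
  "lab (relabel_edge f g x) = g (lab x)"
  by (cases x; simp add: relabel_edge_def src_def tgt_def lab_def)+

lemma relabel_simps [simp]:
  "verts (relabel f g G) = f ` verts G"
  "edges (relabel f g G) = relabel_edge f g ` edges G"
  by (simp_all add: relabel_def)

lemma edge_eqI: "src x = src y \<Longrightarrow> tgt x = tgt y \<Longrightarrow> lab x = lab y \<Longrightarrow> x = y"
  by (cases x, cases y) (simp add: src_def tgt_def lab_def)

lemma relabel_edge_inverse:
  assumes "\<And>x. f' (f x) = x" "\<And>x. g' (g x) = x"
  shows "relabel_edge f' g' (relabel_edge f g x) = x"
  by (rule edge_eqI) (simp_all add: assms)

lemma relabel_inverse:
  assumes "\<And>x. f' (f x) = x" "\<And>x. g' (g x) = x"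
  shows "relabel f' g' (relabel f g G) = G"
proof -
  have "relabel_edge f' g' (relabel_edge f g x) = x" for x
    using assms by (rule relabel_edge_inverse)
  then show ?thesis by (cases G) (simp add: relabel_def image_image assms)
qed

lemma inj_relabel: "inj f \<Longrightarrow> inj g \<Longrightarrow> inj (relabel f g)"
  by (rule inj_on_inverseI[where g = "relabel (inv f) (inv g)"]) (simp add: relabel_inverse)

lemma inj_on_lab_relabel:
  assumes "inj g" "inj_on lab E"
  shows "inj_on lab (relabel_edge f g ` E)"
proof (rule inj_on_imageI)
  have "lab \<circ> relabel_edge f g = g \<circ> lab" by (simp add: fun_eq_iff)
  moreover have "inj_on (g \<circ> lab) E"
    using assms by (intro comp_inj_on) (auto intro: inj_on_subset)
  ultimately show "inj_on (lab \<circ> relabel_edge f g) E" by simp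
qed

lemma multigraph_relabel:
  assumes "inj g" "multigraph G"
  shows "multigraph (relabel f g G)"
  using assms by (auto simp: multigraph_def inj_on_lab_relabel)

text \<open>Compose the given bijections with the inverse relabelling. Since \<open>f\<close> and
  \<open>g\<close> are injective on all integers, \<open>relabel_edge (inv f) (inv g)\<close> undoes
  the relabelling on every edge, so end points are still respected.\<close>

lemma isomorphic_relabel:
  assumes "inj f" "inj g" "isomorphic G H"
  shows "isomorphic (relabel f g G) H"
proof -
  obtain a b where ab: "bij_betw a (verts G) (verts H)" "bij_betw b (edges G) (edges H)"
    "\<forall>x\<in>edges G. src (b x) = a (src x) \<and> tgt (b x) = a (tgt x)"
    using assms(3) unfolding isomorphic_def by blast
  let ?h = "relabel_edge (inv f) (inv g)"
  have h: "?h (relabel_edge f g x) = x" for x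
    using assms by (simp add: relabel_edge_inverse)
  have "bij_betw (inv f) (f ` verts G) (verts G)"
    by (rule bij_betw_byWitness[where f' = f]) (use assms in auto)
  moreover have "bij_betw ?h (relabel_edge f g ` edges G) (edges G)"
    by (rule bij_betw_byWitness[where f' = "relabel_edge f g"]) (auto simp only: h image_iff)
  ultimately have "bij_betw (a \<circ> inv f) (f ` verts G) (verts H)"
    "bij_betw (b \<circ> ?h) (relabel_edge f g ` edges G) (edges H)"
    using ab by (auto intro: bij_betw_trans)
  then show ?thesis
    unfolding isomorphic_def using ab assms
    by (intro exI[of _ "a \<circ> inv f"] exI[of _ "b \<circ> ?h"]) (simp add: h)
qed

lemma family_multigraph_relabel:
  "inj f \<Longrightarrow> inj g \<Longrightarrow> family_multigraph \<F> G \<Longrightarrow> family_multigraph \<F> (relabel f g G)"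
  unfolding family_multigraph_def by (blast intro: multigraph_relabel isomorphic_relabel)

text \<open>Records the label sets that a patchwork occupies, not just their sizes, so that
  patchworks inside a given multigraph can be sorted by \<open>(V, L)\<close>. Initial segments give
  back the canonical patchworks.\<close>

definition patchworks_on :: "mgraph set \<Rightarrow> int set \<Rightarrow> int set \<Rightarrow> mgraph set set" where
  "patchworks_on \<F> V L = {P. patchwork \<F> P \<and> pverts P = V \<and> lab ` pedges P = L}"

section \<open>Transport of patchworks to other label sets\<close>

lemma pverts_relabel: "pverts (relabel f g ` P) = f ` pverts P"
  by (auto simp: pverts_def)

lemma pedges_relabel: "pedges (relabel f g ` P) = relabel_edge f g ` pedges P"
  by (auto simp: pedges_def)

lemma relabel_patchworks_on:
  assumes "inj f" "inj g" "P \<in> patchworks_on \<F> V L"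
  shows "relabel f g ` P \<in> patchworks_on \<F> (f ` V) (g ` L)"
proof -
  have "inj_on lab (pedges P)" using assms by (simp add: patchworks_on_def patchwork_def)
  then have "inj_on lab (pedges (relabel f g ` P))"
    unfolding pedges_relabel by (rule inj_on_lab_relabel[OF assms(2)])
  moreover have "lab ` pedges (relabel f g ` P) = g ` L"
    using assms by (simp add: patchworks_on_def pedges_relabel image_image)
      (simp add: image_image[symmetric])
  ultimately show ?thesis
    using assms by (auto simp: patchworks_on_def patchwork_def pverts_relabel
        family_multigraph_relabel)
qed

text \<open>Relabellings are maps on the whole type, so a bijection between two finite label sets
  must be extended to a permutation of the type. It is built in three pieces: \<open>A\<close> to
  \<open>B\<close>, the rest of \<open>A \<union> B\<close> to what remains there, and the identity
  elsewhere.\<close>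

lemma bij_extending_finite:
  fixes A B :: "'a set"
  assumes "finite A" "finite B" "card A = card B"
  obtains f where "bij f" "f ` A = B"
proof -
  let ?C = "A \<union> B"
  obtain a where a: "bij_betw a A B"
    using assms finite_same_card_bij by blast
  \<comment> \<open>These are \<open>B - A\<close> and \<open>A - B\<close>, of equal size because
    \<open>A\<close> and \<open>B\<close> are.\<close>
  have "card (?C - A) = card (?C - B)"
    using assms by (simp add: card_Diff_subset)
  then obtain b where b: "bij_betw b (?C - A) (?C - B)"
    using assms finite_same_card_bij by (metis finite_Diff finite_UnI)
  define f where "f x = (if x \<in> A then a x else if x \<in> B then b x else x)" for x
  have fA: "bij_betw f A B" using a by (rule bij_betw_cong[THEN iffD1, rotated]) (simp add: f_def)
  moreover have "bij_betw f (?C - A) (?C - B)"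
    using b by (rule bij_betw_cong[THEN iffD1, rotated]) (auto simp: f_def)
  moreover have "bij_betw f (- ?C) (- ?C)"
    using bij_betw_id by (rule bij_betw_cong[THEN iffD1, rotated]) (auto simp: f_def)
  ultimately have "bij_betw f (A \<union> (?C - A) \<union> - ?C) (B \<union> (?C - B) \<union> - ?C)"
    by (intro bij_betw_combine) auto
  moreover have "A \<union> (?C - A) \<union> - ?C = UNIV" "B \<union> (?C - B) \<union> - ?C = UNIV" by auto
  ultimately have "bij f" by metis
  then show thesis using fA that by (simp add: bij_betw_def)
qed

text \<open>Relabelling the pieces is a bijection between the two index sets, inverted by
  relabelling with \<open>inv f\<close> and \<open>inv g\<close>, and it keeps the number of
  pieces.\<close>

lemma sum_patchworks_on_relabel:
  assumes "bij f" "bij g"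
  shows "(\<Sum>P\<in>patchworks_on \<F> (f ` V) (g ` L). h (card P)) = (\<Sum>P\<in>patchworks_on \<F> V L. h (card P))"
proof (rule sum.reindex_bij_witness[where
      i = "image (relabel f g)" and j = "image (relabel (inv f) (inv g))"])
  have inj: "inj f" "inj g" "inj (inv f)" "inj (inv g)"
    using assms by (auto simp: bij_is_inj bij_imp_bij_inv)
  have eq: "f (inv f x) = x" "g (inv g x) = x" for x
    using assms by (simp_all add: bij_is_surj surj_f_inv_f)
  fix P
  show "relabel f g ` P \<in> patchworks_on \<F> (f ` V) (g ` L)" if "P \<in> patchworks_on \<F> V L"
    by (rule relabel_patchworks_on[OF inj(1,2) that])
  show "relabel (inv f) (inv g) ` relabel f g ` P = P"
    using inj by (simp add: image_image relabel_inverse)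
  assume P: "P \<in> patchworks_on \<F> (f ` V) (g ` L)"
  show "relabel f g ` relabel (inv f) (inv g) ` P = P"
    using eq by (simp add: image_image relabel_inverse)
  show "relabel (inv f) (inv g) ` P \<in> patchworks_on \<F> V L"
    using relabel_patchworks_on[OF inj(3,4) P] inj by (simp add: image_image)
  show "h (card (relabel (inv f) (inv g) ` P)) = h (card P)"
    using inj by (simp add: card_image inj_on_subset[OF inj_relabel])
qed

text \<open>The definitions differ in whether edges or edge labels are counted; \<open>lab\<close>
  is injective on the edges of a patchwork, so the counts agree.\<close>

lemma canonical_patchworks_eq:
  "canonical_patchworks \<F> n m = patchworks_on \<F> {1..int n} {1..int m}"
proof -
  have "card (pedges P) = m" if "patchwork \<F> P" "lab ` pedges P = {1..int m}" for P
    using that card_image[of lab "pedges P"] by (simp add: patchwork_def)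
  then show ?thesis
    by (auto simp: canonical_patchworks_def canonical_patchwork_def patchworks_on_def)
qed

text \<open>Transport along permutations of the integers that carry initial segments onto
  \<open>V\<close> and \<open>L\<close>.\<close>

lemma sum_patchworks_on:
  assumes "finite V" "finite L"
  shows "(\<Sum>P\<in>patchworks_on \<F> V L. h (card P)) =
    (\<Sum>P\<in>canonical_patchworks \<F> (card V) (card L). h (card P))"
proof -
  obtain f where f: "bij f" "f ` {1..int (card V)} = V"
    by (rule bij_extending_finite[of "{1..int (card V)}" V]) (use assms in auto)
  obtain g where g: "bij g" "g ` {1..int (card L)} = L"
    by (rule bij_extending_finite[of "{1..int (card L)}" L]) (use assms in auto)
  show ?thesis
    using sum_patchworks_on_relabel[OF f(1) g(1), of h \<F> "{1..int (card V)}" "{1..int (card L)}"]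
    by (simp add: f(2) g(2) canonical_patchworks_eq)
qed

section \<open>Multigraphs containing a patchwork\<close>

lemma edge_triple: "x = (src x, tgt x, lab x)"
  by (rule edge_eqI) (simp_all add: src_def tgt_def lab_def)

lemma nm_multigraph_edges_subset:
  assumes "nm_multigraph n m G"
  shows "edges G \<subseteq> {1..int n} \<times> {1..int n} \<times> {1..int m}"
proof
  fix x assume "x \<in> edges G"
  then have "src x \<in> {1..int n}" "tgt x \<in> {1..int n}" "lab x \<in> {1..int m}"
    using assms unfolding nm_multigraph_def multigraph_def by blast+
  then show "x \<in> {1..int n} \<times> {1..int n} \<times> {1..int m}"
    by (subst edge_triple) simp
qed

section \<open>Finiteness of the sets to be counted\<close>

lemma finite_nm_multigraphs: "finite {G. nm_multigraph n m G}"
proof (rule finite_subset)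
  show "{G. nm_multigraph n m G} \<subseteq>
    MGraph {1..int n} ` Pow ({1..int n} \<times> {1..int n} \<times> {1..int m})"
  proof clarify
    fix G assume "nm_multigraph n m G"
    then show "G \<in> MGraph {1..int n} ` Pow ({1..int n} \<times> {1..int n} \<times> {1..int m})"
      using nm_multigraph_edges_subset[of n m G]
      by (intro image_eqI[where x = "edges G"]) (cases G; auto simp: nm_multigraph_def)+
  qed
qed simp

lemma finite_family_subgraphs:
  assumes "multigraph G"
  shows "finite (family_subgraphs \<F> G)"
proof (rule finite_subset)
  show "family_subgraphs \<F> G \<subseteq> case_prod MGraph ` (Pow (verts G) \<times> Pow (edges G))"
  proof
    fix H assume "H \<in> family_subgraphs \<F> G"
    then show "H \<in> case_prod MGraph ` (Pow (verts G) \<times> Pow (edges G))"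
      by (intro image_eqI[where x = "(verts H, edges H)"])
        (auto simp: family_subgraphs_def subgraph_def)
  qed
  show "finite (case_prod MGraph ` (Pow (verts G) \<times> Pow (edges G)))"
    using assms by (simp add: multigraph_def)
qed

text \<open>Makes distinguished subgraphs and patchworks interchangeable: subgraphs of a common
  \<open>G\<close> share its labelling, so finiteness and the injectivity of \<open>lab\<close> on
  their union are inherited from \<open>G\<close>.\<close>

lemma subset_family_subgraphs_iff:
  assumes "multigraph G"
  shows "P \<subseteq> family_subgraphs \<F> G \<longleftrightarrow>
    patchwork \<F> P \<and> pverts P \<subseteq> verts G \<and> pedges P \<subseteq> edges G"
proof
  assume P: "P \<subseteq> family_subgraphs \<F> G"
  then have "pverts P \<subseteq> verts G" "pedges P \<subseteq> edges G"
    by (auto simp: family_subgraphs_def subgraph_def pverts_def pedges_def)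
  moreover have "finite P"
    using P finite_family_subgraphs[OF assms] by (rule finite_subset)
  moreover have "inj_on lab (pedges P)"
    using \<open>pedges P \<subseteq> edges G\<close> assms by (auto simp: multigraph_def intro: inj_on_subset)
  ultimately show "patchwork \<F> P \<and> pverts P \<subseteq> verts G \<and> pedges P \<subseteq> edges G"
    using P by (auto simp: patchwork_def family_subgraphs_def)
next
  assume "patchwork \<F> P \<and> pverts P \<subseteq> verts G \<and> pedges P \<subseteq> edges G"
  then show "P \<subseteq> family_subgraphs \<F> G"
    by (auto simp: family_subgraphs_def subgraph_def patchwork_def pverts_def pedges_def)
qed

lemma card_nm_multigraphs_extending:
  assumes inj: "inj_on lab E" and L: "lab ` E \<subseteq> {1..int m}"
    and ends: "\<And>x. x \<in> E \<Longrightarrow> src x \<in> {1..int n} \<and> tgt x \<in> {1..int n}"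
  shows "card {G. nm_multigraph n m G \<and> E \<subseteq> edges G} = (n ^ 2) ^ (m - card (lab ` E))"
proof -
  let ?V = "{1..int n}" and ?R = "{1..int m} - lab ` E"
  let ?F = "?R \<rightarrow>\<^sub>E ?V \<times> ?V"
  define extra where "extra f = (\<lambda>l. (fst (f l), snd (f l), l)) ` ?R"
    for f :: "int \<Rightarrow> int \<times> int"
  define h where "h f = MGraph ?V (E \<union> extra f)" for f
  have lab_extra: "lab ` extra f = ?R" for f
    by (simp add: extra_def image_image lab_def)
  have finE: "finite E"
    using inj L finite_imageD finite_subset by blast
  have "inj_on h ?F"
  proof (rule inj_onI)
    fix f f' assume f: "f \<in> ?F" "f' \<in> ?F" and "h f = h f'"
    then have eq: "E \<union> extra f = E \<union> extra f'" by (simp add: h_def)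
    show "f = f'"
    proof (rule PiE_ext[OF f])
      fix l assume l: "l \<in> ?R"
      then have "(fst (f l), snd (f l), l) \<in> E \<union> extra f'"
        using eq unfolding extra_def by blast
      \<comment> \<open>The label \<open>l\<close> is free, so this edge must come from
        \<open>extra f'\<close>, where \<open>l\<close> determines the edge.\<close>
      moreover have "(fst (f l), snd (f l), l) \<notin> E"
        using l by (force simp: lab_def)
      ultimately show "f l = f' l" by (auto simp: extra_def prod_eq_iff)
    qed
  qed
  moreover have "h ` ?F = {G. nm_multigraph n m G \<and> E \<subseteq> edges G}"
  proof (intro equalityI subsetI)
    fix G assume "G \<in> h ` ?F"
    then obtain f where f: "f \<in> ?F" and G: "G = h f" by blast
    have V: "src x \<in> ?V \<and> tgt x \<in> ?V" if x: "x \<in> extra f" for x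
    proof -
      obtain l where l: "l \<in> ?R" "x = (fst (f l), snd (f l), l)"
        using x unfolding extra_def by blast
      have "f l \<in> ?V \<times> ?V" using f l(1) by (rule PiE_mem)
      then show ?thesis using l(2) by (auto simp: src_def tgt_def)
    qed
    have "inj_on lab (extra f)"
      by (auto simp: extra_def inj_on_def lab_def)
    then have "inj_on lab (E \<union> extra f)"
      using inj lab_extra[of f] unfolding inj_on_Un by blast
    moreover have "lab ` (E \<union> extra f) = {1..int m}"
      using L by (auto simp: image_Un lab_extra)
    moreover have "finite (extra f)" by (simp add: extra_def)
    ultimately show "G \<in> {G. nm_multigraph n m G \<and> E \<subseteq> edges G}"
      using V ends finE
      by (auto simp: G h_def nm_multigraph_def multigraph_def simp del: atLeastAtMost_iff)
  next
    fix G assume "G \<in> {G. nm_multigraph n m G \<and> E \<subseteq> edges G}"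
    then have G: "nm_multigraph n m G" and E: "E \<subseteq> edges G" by auto
    then have injG: "inj_on lab (edges G)" and labG: "lab ` edges G = {1..int m}"
      and VG: "verts G = ?V"
      by (auto simp: nm_multigraph_def multigraph_def)
    \<comment> \<open>\<open>e\<close> sends a label to the unique edge of \<open>G\<close> carrying
      it. The function sought reads off the end points of \<open>e l\<close>, restricted to the free
      labels so that it lies in the extensional function space \<open>?F\<close>.\<close>
    define e where "e = the_inv_into (edges G) lab"
    have e: "e l \<in> edges G" "lab (e l) = l" if "l \<in> {1..int m}" for l
      using that labG the_inv_into_into[OF injG, of l] f_the_inv_into_f[OF injG, of l]
      by (auto simp: e_def)
    have e': "e (lab x) = x" if "x \<in> edges G" for x
      using that by (simp add: e_def the_inv_into_f_f[OF injG])
    define f where "f = restrict (\<lambda>l. (src (e l), tgt (e l))) ?R"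
    have "f \<in> ?F"
      using e(1) G by (auto simp: f_def nm_multigraph_def multigraph_def simp del: atLeastAtMost_iff)
    moreover have "extra f = e ` ?R"
      unfolding extra_def
    proof (rule image_cong[OF refl])
      fix l assume "l \<in> ?R"
      then show "(fst (f l), snd (f l), l) = e l"
        using edge_triple[of "e l"] e(2)[of l] by (simp add: f_def)
    qed
    moreover have "E \<union> e ` ?R = edges G"
    proof
      show "E \<union> e ` ?R \<subseteq> edges G" using E e(1) by blast
      show "edges G \<subseteq> E \<union> e ` ?R"
      proof
        fix x assume x: "x \<in> edges G"
        show "x \<in> E \<union> e ` ?R"
        proof (cases "lab x \<in> lab ` E")
          case True
          \<comment> \<open>The edge of \<open>E\<close> with the same label as \<open>x\<close>
            also lies in \<open>G\<close>, hence is \<open>x\<close> itself.\<close>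
          then show ?thesis using x E injG by (auto dest: inj_onD)
        next
          case False
          then have "lab x \<in> ?R" using x labG by blast
          then show ?thesis using e'[OF x] by (metis UnI2 image_eqI)
        qed
      qed
    qed
    ultimately have "G = h f" using VG by (cases G) (simp add: h_def)
    then show "G \<in> h ` ?F" using \<open>f \<in> ?F\<close> by blast
  qed
  ultimately have "card {G. nm_multigraph n m G \<and> E \<subseteq> edges G} = card ?F"
    using card_image[of h ?F] by simp
  also have "\<dots> = (n ^ 2) ^ card ?R"
    by (simp add: card_PiE power2_eq_square)
  also have "card ?R = m - card (lab ` E)"
    using L finE by (subst card_Diff_subset) auto
  finally show ?thesis .
qed

text \<open>The vertices of \<open>P\<close> lie in \<open>{1..int n}\<close> anyway, so containing
  the pieces of \<open>P\<close> just means containing the edges of \<open>P\<close>, and the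
  previous count applies.\<close>

lemma card_nm_multigraphs_containing:
  assumes P: "P \<in> patchworks_on \<F> V L" and "V \<subseteq> {1..int n}" "L \<subseteq> {1..int m}"
  shows "card {G. nm_multigraph n m G \<and> P \<subseteq> family_subgraphs \<F> G} = (n ^ 2) ^ (m - card L)"
proof -
  have "P \<subseteq> family_subgraphs \<F> G \<longleftrightarrow> pedges P \<subseteq> edges G" if "nm_multigraph n m G" for G
    using that assms subset_family_subgraphs_iff[of G P \<F>]
    by (auto simp: patchworks_on_def nm_multigraph_def)
  then have "{G. nm_multigraph n m G \<and> P \<subseteq> family_subgraphs \<F> G} =
    {G. nm_multigraph n m G \<and> pedges P \<subseteq> edges G}" by blast
  moreover have "src x \<in> {1..int n} \<and> tgt x \<in> {1..int n}" if "x \<in> pedges P" for x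
  proof -
    have "src x \<in> pverts P \<and> tgt x \<in> pverts P"
      using that P unfolding patchworks_on_def patchwork_def family_multigraph_def multigraph_def
        pverts_def pedges_def by blast
    then show ?thesis using assms by (auto simp: patchworks_on_def)
  qed
  ultimately show ?thesis
    using card_nm_multigraphs_extending[of "pedges P" m n] assms
    by (auto simp: patchworks_on_def patchwork_def)
qed

lemma family_subgraphs_patchworks_on:
  assumes G: "nm_multigraph n m G" and P: "P \<subseteq> family_subgraphs \<F> G"
  shows "pverts P \<subseteq> {1..int n}" "lab ` pedges P \<subseteq> {1..int m}"
    "P \<in> patchworks_on \<F> (pverts P) (lab ` pedges P)"
proof -
  have *: "patchwork \<F> P" "pverts P \<subseteq> verts G" "pedges P \<subseteq> edges G"
    using assms subset_family_subgraphs_iff[of G P \<F>] by (auto simp: nm_multigraph_def)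
  then show "pverts P \<subseteq> {1..int n}" "lab ` pedges P \<subseteq> {1..int m}"
    using G image_mono[of "pedges P" "edges G" lab] by (simp_all add: nm_multigraph_def)
  show "P \<in> patchworks_on \<F> (pverts P) (lab ` pedges P)"
    using * by (simp add: patchworks_on_def)
qed

section \<open>Double counting\<close>

lemma sum_Pow_power_card:
  fixes q :: "'b::comm_semiring_1"
  assumes "finite A"
  shows "(\<Sum>P\<in>Pow A. q ^ card P) = (1 + q) ^ card A"
  \<comment> \<open>Expand the product of the factors \<open>q + 1\<close> over \<open>A\<close>: a
    subset records the factors from which \<open>q\<close> is taken.\<close>
  using assms prod_add[of A "\<lambda>_. q" "\<lambda>_. 1"] by (simp add: add.commute)

lemma sum_Pow_card:
  fixes h :: "nat \<Rightarrow> 'b::comm_semiring_1"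
  assumes "finite A"
  shows "(\<Sum>V\<in>Pow A. h (card V)) = (\<Sum>k\<le>card A. of_nat (card A choose k) * h k)"
proof -
  have "(\<Sum>V\<in>Pow A. h (card V)) = (\<Sum>k\<le>card A. \<Sum>V\<in>{V\<in>Pow A. card V = k}. h (card V))"
    using assms by (intro sum.group[symmetric]) (auto intro: card_mono)
  also have "\<dots> = (\<Sum>k\<le>card A. of_nat (card A choose k) * h k)"
    using n_subsets[OF assms] by (intro sum.cong) auto
  finally show ?thesis .
qed

lemma finite_patchworks_on:
  assumes "finite V" "finite L"
  shows "finite (patchworks_on \<F> V L)"
proof (rule finite_subset)
  show "patchworks_on \<F> V L \<subseteq> Pow (case_prod MGraph ` (Pow V \<times> Pow (V \<times> V \<times> L)))"
  proof clarify
    fix P G assume P: "P \<in> patchworks_on \<F> V L" and G: "G \<in> P"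
    have V: "verts G \<subseteq> V" and mg: "multigraph G"
      using P G by (auto simp: patchworks_on_def patchwork_def family_multigraph_def pverts_def)
    have "edges G \<subseteq> V \<times> V \<times> L"
    proof
      fix x assume x: "x \<in> edges G"
      then have "src x \<in> V" "tgt x \<in> V" "lab x \<in> L"
        using mg V P G unfolding multigraph_def patchworks_on_def pedges_def by blast+
      then show "x \<in> V \<times> V \<times> L" by (subst edge_triple) simp
    qed
    with V show "G \<in> case_prod MGraph ` (Pow V \<times> Pow (V \<times> V \<times> L))"
      by (intro image_eqI[where x = "(verts G, edges G)"]) auto
  qed
qed (use assms in simp)

text \<open>The double count, for a general weight \<open>q\<close> per distinguished subgraph;
  \<open>q\<close> will be specialised to \<open>u - 1\<close>.\<close>

lemma sum_power_family_subgraphs: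
  fixes q :: "'b::comm_ring_1"
  shows "(\<Sum>G | nm_multigraph n m G. (1 + q) ^ card (family_subgraphs \<F> G)) =
    (\<Sum>k\<le>n. of_nat (n choose k) * (\<Sum>j\<le>m. of_nat (m choose j) *
      (of_nat ((n ^ 2) ^ (m - j)) * (\<Sum>P\<in>canonical_patchworks \<F> k j. q ^ card P))))"
proof -
  let ?G = "{G. nm_multigraph n m G}" and ?N = "{1..int n}" and ?M = "{1..int m}"
  \<comment> \<open>\<open>Q\<close> is a finite index set, independent of \<open>G\<close>,
    containing every patchwork that can occur inside an \<open>(n, m)\<close>-multigraph; this
    permits the exchange of sums. \<open>K\<close> gives the label sets by which \<open>Q\<close> is
    later split.\<close>
  define Q where "Q = (\<Union>V\<in>Pow ?N. \<Union>L\<in>Pow ?M. patchworks_on \<F> V L)"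
  define S where "S = Pow ?N \<times> Pow ?M"
  define K where "K P = (pverts P, lab ` pedges P)" for P
  have Q: "P \<in> Q \<longleftrightarrow> patchwork \<F> P \<and> K P \<in> S" for P
    by (auto simp: Q_def S_def K_def patchworks_on_def)
  have finS: "finite S" by (simp add: S_def)
  have finQ: "finite Q"
    unfolding Q_def by (intro finite_UN_I finite_patchworks_on) (auto intro: finite_subset)
  have "(\<Sum>G\<in>?G. (1 + q) ^ card (family_subgraphs \<F> G)) =
    (\<Sum>G\<in>?G. \<Sum>P | P \<in> Q \<and> P \<subseteq> family_subgraphs \<F> G. q ^ card P)"
  proof (rule sum.cong[OF refl])
    fix G assume G: "G \<in> ?G"
    then have "finite (family_subgraphs \<F> G)"
      by (intro finite_family_subgraphs) (simp add: nm_multigraph_def)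
    moreover have "{P. P \<in> Q \<and> P \<subseteq> family_subgraphs \<F> G} = Pow (family_subgraphs \<F> G)"
    proof -
      have "P \<in> Q" if "P \<subseteq> family_subgraphs \<F> G" for P
        using family_subgraphs_patchworks_on[OF _ that] G
        by (simp add: Q K_def S_def patchworks_on_def)
      then show ?thesis by blast
    qed
    ultimately show "(1 + q) ^ card (family_subgraphs \<F> G) =
      (\<Sum>P | P \<in> Q \<and> P \<subseteq> family_subgraphs \<F> G. q ^ card P)"
      by (simp add: sum_Pow_power_card)
  qed
  \<comment> \<open>Now choose the patchwork first and then the multigraphs around it.\<close>
  also have "\<dots> = (\<Sum>P\<in>Q. \<Sum>G | G \<in> ?G \<and> P \<subseteq> family_subgraphs \<F> G. q ^ card P)"
    by (rule sum.swap_restrict[OF finite_nm_multigraphs finQ])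
  also have "\<dots> = (\<Sum>P\<in>Q. of_nat ((n ^ 2) ^ (m - card (lab ` pedges P))) * q ^ card P)"
  proof (rule sum.cong[OF refl])
    fix P assume "P \<in> Q"
    then have "card {G. nm_multigraph n m G \<and> P \<subseteq> family_subgraphs \<F> G} =
      (n ^ 2) ^ (m - card (lab ` pedges P))"
      by (intro card_nm_multigraphs_containing[where V = "pverts P" and \<F> = \<F>])
        (auto simp: Q K_def S_def patchworks_on_def)
    then show "(\<Sum>G | G \<in> ?G \<and> P \<subseteq> family_subgraphs \<F> G. q ^ card P) =
      of_nat ((n ^ 2) ^ (m - card (lab ` pedges P))) * q ^ card P" by simp
  qed
  also have "\<dots> = (\<Sum>s\<in>S. \<Sum>P\<in>{P\<in>Q. K P = s}.
      of_nat ((n ^ 2) ^ (m - card (lab ` pedges P))) * q ^ card P)"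
    by (rule sum.group[symmetric, OF finQ finS]) (auto simp: Q)
  also have "\<dots> = (\<Sum>(V, L)\<in>S. of_nat ((n ^ 2) ^ (m - card L)) *
      (\<Sum>P\<in>patchworks_on \<F> V L. q ^ card P))"
  proof (rule sum.cong[OF refl], clarify)
    fix V L assume "(V, L) \<in> S"
    then have "{P \<in> Q. K P = (V, L)} = patchworks_on \<F> V L"
      by (auto simp: Q K_def patchworks_on_def)
    then show "(\<Sum>P\<in>{P\<in>Q. K P = (V, L)}.
        of_nat ((n ^ 2) ^ (m - card (lab ` pedges P))) * q ^ card P) =
      of_nat ((n ^ 2) ^ (m - card L)) * (\<Sum>P\<in>patchworks_on \<F> V L. q ^ card P)"
      by (auto simp: sum_distrib_left patchworks_on_def intro!: sum.cong)
  qed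
  \<comment> \<open>By transport, the inner sum depends only on the sizes of \<open>V\<close> and
    \<open>L\<close>; counting label sets of each size then gives the binomial coefficients.\<close>
  also have "\<dots> = (\<Sum>V\<in>Pow ?N. \<Sum>L\<in>Pow ?M. of_nat ((n ^ 2) ^ (m - card L)) *
      (\<Sum>P\<in>canonical_patchworks \<F> (card V) (card L). q ^ card P))"
    unfolding S_def sum.cartesian_product[symmetric]
    by (intro sum.cong refl arg_cong2[where f = "(*)"] sum_patchworks_on)
      (auto intro: finite_subset)
  also have "\<dots> = (\<Sum>k\<le>n. of_nat (n choose k) * (\<Sum>j\<le>m. of_nat (m choose j) *
      (of_nat ((n ^ 2) ^ (m - j)) * (\<Sum>P\<in>canonical_patchworks \<F> k j. q ^ card P))))"
    by (subst sum_Pow_card, simp, subst sum_Pow_card, simp, simp)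
  finally show ?thesis .
qed

section \<open>Coefficient extraction\<close>

lemma smult_sum_right: "smult c (sum f A) = (\<Sum>x\<in>A. smult c (f x))"
  by (induction A rule: infinite_finite_induct) (simp_all add: smult_add_right)

lemma pcompose_monom: "pcompose (monom c k) q = smult c (q ^ k)"
  for q :: "'a::comm_semiring_1 poly"
  by (induction k) (simp_all add: monom_0 monom_Suc pcompose_pCons mult.commute)

lemma nth_subst_Patch:
  "fps_nth (fps_nth (subst_u q (Patch \<F>)) k) j =
    smult (1 / (2 ^ j * fact j * fact k)) (\<Sum>P\<in>canonical_patchworks \<F> k j. q ^ card P)"
  by (simp add: subst_u_def map_fps_def Patch_def pcompose_sum pcompose_monom smult_sum_right)

text \<open>A Cauchy product in each variable: the coefficients of \<open>exp_z a\<close> are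
  constant in \<open>w\<close>, and \<open>exp_w b\<close> is constant in \<open>z\<close>, so the
  two convolutions do not interact.\<close>

lemma nth_mult_exp_z_exp_w:
  "fps_nth (fps_nth (A * exp_z a * exp_w b) n) m =
    (\<Sum>k\<le>n. \<Sum>j\<le>m. smult (a ^ (n - k) / fact (n - k) * (b ^ (m - j) / fact (m - j)))
      (fps_nth (fps_nth A k) j))"
proof -
  have "fps_nth (A * exp_z a) n = (\<Sum>k\<le>n. fps_nth A k * fps_const [:a ^ (n - k) / fact (n - k):])"
    by (simp add: fps_mult_nth exp_z_def map_fps_def atLeast0AtMost)
  then have nth: "fps_nth (fps_nth (A * exp_z a) n) j =
      (\<Sum>k\<le>n. smult (a ^ (n - k) / fact (n - k)) (fps_nth (fps_nth A k) j))" for j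
    by (simp add: fps_sum_nth)
  have "fps_nth (fps_nth (A * exp_z a * exp_w b) n) m =
    (\<Sum>j\<le>m. \<Sum>k\<le>n. smult (a ^ (n - k) / fact (n - k) * (b ^ (m - j) / fact (m - j)))
      (fps_nth (fps_nth A k) j))"
    \<comment> \<open>The instantiation confines the convolution to the inner series in
      \<open>w\<close>; the outer factor is an \<open>fps_const\<close> and acts
      coefficientwise.\<close>
    by (simp add: exp_w_def fps_mult_nth[of "fps_nth _ _"] map_fps_def nth atLeast0AtMost
        smult_sum_right mult.commute)
  then show ?thesis by (subst (asm) sum.swap)
qed

text \<open>A power of the polynomial variable contributes 1 to the coefficient at \<open>t\<close>
  exactly when its exponent is \<open>t\<close>. This turns the weighted sum into the wanted
  count.\<close>

lemma coeff_sum_power_card: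
  assumes "finite A"
  shows "coeff (\<Sum>G\<in>A. [:0, 1:] ^ card (s G)) t =
    (of_nat (card {G\<in>A. card (s G) = t}) :: 'a::comm_semiring_1)"
proof -
  have "coeff (\<Sum>G\<in>A. [:0, 1:] ^ card (s G)) t = (\<Sum>G\<in>A. if card (s G) = t then 1 else (0 :: 'a))"
    by (simp add: coeff_sum monom_altdef[of 1, simplified, symmetric])
  also have "\<dots> = of_nat (card {G\<in>A. card (s G) = t})"
    using assms by (simp add: sum.If_cases Int_def)
  finally show ?thesis .
qed

theorem theorem5p3:
  fixes \<F> :: "mgraph set" and n m t :: nat
  assumes "multigraph_family \<F>"
  shows "of_nat (MG \<F> n m t) =
    fact n * 2 ^ m * fact m *
      coeff_zwu n m t (subst_u [:-1, 1:] (Patch \<F>) * exp_z 1 * exp_w (of_nat n ^ 2 / 2))"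
proof -
  let ?q = "[:-1, 1:] :: rat poly"
  let ?T = "\<lambda>k j. \<Sum>P\<in>canonical_patchworks \<F> k j. ?q ^ card P"
  \<comment> \<open>The product of three coefficients: of \<open>e^z\<close> at
    \<open>n - k\<close>, of the exponential in \<open>w\<close> at \<open>m - j\<close>, and the
    normalisation of \<open>Patch\<close> at \<open>(k, j)\<close>.\<close>
  let ?c = "\<lambda>k j. 1 / fact (n - k) * ((of_nat n ^ 2 / 2) ^ (m - j) / fact (m - j)) *
    (1 / (2 ^ j * fact j * fact k)) :: rat"
  have const: "fact n * 2 ^ m * fact m * ?c k j =
    of_nat (n choose k) * of_nat (m choose j) * of_nat ((n ^ 2) ^ (m - j))"
    if "k \<le> n" "j \<le> m" for k j
  proof -
    \<comment> \<open>The factor \<open>2 ^ j\<close> cancels the normalisation of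
      \<open>Patch\<close>, and \<open>2 ^ (m - j)\<close> clears the halves in
      \<open>(of_nat n ^ 2 / 2) ^ (m - j)\<close>. The factorials combine into the two binomial
      coefficients.\<close>
    have "(2 :: rat) ^ m = 2 ^ j * 2 ^ (m - j)"
      using that by (simp flip: power_add)
    then show ?thesis
      using that by (simp add: binomial_fact power_divide field_simps)
  qed
  have "smult (fact n * 2 ^ m * fact m) (fps_nth (fps_nth
      (subst_u ?q (Patch \<F>) * exp_z 1 * exp_w (of_nat n ^ 2 / 2)) n) m) =
    (\<Sum>k\<le>n. \<Sum>j\<le>m. smult (fact n * 2 ^ m * fact m * ?c k j) (?T k j))"
    unfolding nth_mult_exp_z_exp_w nth_subst_Patch by (simp add: smult_sum_right)
  also have "\<dots> = (\<Sum>k\<le>n. \<Sum>j\<le>m. smult (of_nat (n choose k) * of_nat (m choose j) *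
      of_nat ((n ^ 2) ^ (m - j))) (?T k j))"
    using const by (intro sum.cong) auto
  \<comment> \<open>Natural numbers are read as constant polynomials, so scalar multiples become
    products, in the form of the double count.\<close>
  also have "\<dots> = (\<Sum>k\<le>n. of_nat (n choose k) * (\<Sum>j\<le>m. of_nat (m choose j) *
      (of_nat ((n ^ 2) ^ (m - j)) * ?T k j)))"
    by (intro sum.cong refl)
      (simp add: of_nat_poly smult_sum_right mult_ac sum_distrib_left del: of_nat_mult of_nat_power)
  also have "\<dots> = (\<Sum>G | nm_multigraph n m G. (1 + ?q) ^ card (family_subgraphs \<F> G))"
    by (rule sum_power_family_subgraphs[symmetric])
  \<comment> \<open>The shift by one is undone: \<open>1 + (u - 1) = u\<close>.\<close>
  also have "1 + ?q = [:0, 1:]" by (simp add: one_pCons)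
  finally have "fact n * 2 ^ m * fact m *
      coeff_zwu n m t (subst_u ?q (Patch \<F>) * exp_z 1 * exp_w (of_nat n ^ 2 / 2)) =
    coeff (\<Sum>G | nm_multigraph n m G. [:0, 1:] ^ card (family_subgraphs \<F> G)) t"
    unfolding coeff_zwu_def by (metis coeff_smult)
  then show ?thesis
    by (simp add: coeff_sum_power_card finite_nm_multigraphs MG_def)
qed

end
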